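(* Let $X:U\to\mathbb{R}^4_2$ be an immersion of an open set $U\subset\mathbb{R}^2$ whose image $M=X(U)$ is a Lorentzian surface, with adapted frame $\{e_1,e_2,e_3,e_4\}$. Let $p\in U$ and $\sigma\in\{+1,-1\}$, and write $LG_M^\sigma=\widetilde{e_1+\sigma e_2}:U\to S_t^1\times S_s^1$. The following conditions are equivalent: (1) $p$ is a degenerate singular point of the Lorentzian lightcone height function $h_\lambda(x,y)=\langle X(x,y),\lambda\rangle$ with $\lambda=LG_M^\sigma(p)$ (i.e. both first partial derivatives of $h_\lambda$ and the determinant of its Hessian matrix vanish at $p$). (2) There is $\lambda\in S_t^1\times S_s^1$ such that $(p,\lambda)$ is a singular point of the lightcone Gauss map $LG_M^\sigma$; that is, $\lambda=LG_M^\sigma(p)$ and $p$ is a singular point of $LG_M^\sigma$ (the differential of $LG_M^\sigma$ at $p$ has rank less than $2$). (3) $\mathcal{K}_l(1,\sigma)(p)=0$.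
   Context: All maps are $C^\infty$. $\mathbb{R}^4_2$ denotes $\mathbb{R}^4$ with the pseudo scalar product $\langle x,y\rangle=-x_1y_1-x_2y_2+x_3y_3+x_4y_4$. A nonzero vector $x$ is spacelike, lightlike or timelike if $\langle x,x\rangle>0$, $=0$, $<0$ respectively. $M=X(U)$ is identified with $U$ via $X$. It is a Lorentzian surface if at each $p\in U$ the tangent plane $T_pM=dX_p(\mathbb{R}^2)$ is a Lorentzian plane ($\langle\,,\rangle$ restricted to it is nondegenerate of signature $(1,1)$); then the normal plane $N_pM$ is Lorentzian too. An adapted frame is a smooth frame $e_1,e_2,e_3,e_4$ along $U$ of mutually orthogonal vectors with $e_3,e_4$ spanning $T_pM$, $e_1,e_2$ spanning $N_pM$, $\langle e_1,e_1\rangle=\langle e_3,e_3\rangle=-1$, $\langle e_2,e_2\rangle=\langle e_4,e_4\rangle=1$. Put $\omega_3=-\langle dX,e_3\rangle$, $\omega_4=\langle dX,e_4\rangle$, and define functions $a,b,c,\bar a,\bar b,\bar c$ on $U$ by $-\langle de_1,e_3\rangle=a\omega_3+b\omega_4$, $\langle de_1,e_4\rangle=-b\omega_3-c\omega_4$, $-\langle de_2,e_3\rangle=\bar a\omega_3+\bar b\omega_4$, $\langle de_2,e_4\rangle=-\bar b\omega_3-\bar c\omega_4$. The lightlike Gauss-Kronecker curvature function is $\mathcal{K}_l(s,t)=(as+\bar at)(cs+\bar ct)-(bs+\bar bt)^2$, a function on $U$ for each $(s,t)\in\mathbb{R}^2$. $LC_0=\{x\in\mathbb{R}^4_2: -x_1^2-x_2^2+x_3^2+x_4^2=0\}$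 and $S_t^1\times S_s^1=\{x\in LC_0: x_1^2+x_2^2=1\}$, a 2-dimensional torus. For a lightlike vector $x$, $\widetilde{x}=x/\sqrt{x_1^2+x_2^2}\in S_t^1\times S_s^1$; $\widetilde{e_1+\sigma e_2}$ is the map $p\mapsto\widetilde{e_1(p)+\sigma e_2(p)}$. *)

theory Defs
  imports "HOL-Analysis.Analysis"
begin

text \<open>Maps on an open set \<open>U\<close> are total functions of which only the values on \<open>U\<close> matter.
  \<open>C\<^sup>k\<close> is expressed through iterated directional derivatives; this is meant for open \<open>U\<close>.\<close>

primrec Ck_on :: "nat \<Rightarrow> ('a::real_normed_vector) set \<Rightarrow> ('a \<Rightarrow> 'b::real_normed_vector) \<Rightarrow> bool" where
  "Ck_on 0 U f \<longleftrightarrow> continuous_on U f"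
| "Ck_on (Suc k) U f \<longleftrightarrow> (\<forall>x\<in>U. f differentiable (at x)) \<and>
     (\<forall>v. Ck_on k U (\<lambda>x. frechet_derivative f (at x) v))"

definition smooth_on :: "('a::real_normed_vector) set \<Rightarrow> ('a \<Rightarrow> 'b::real_normed_vector) \<Rightarrow> bool" where
  "smooth_on U f \<longleftrightarrow> (\<forall>k. Ck_on k U f)"

definition immersion_on :: "(real^2) set \<Rightarrow> (real^2 \<Rightarrow> real^4) \<Rightarrow> bool" where
  "immersion_on U X \<longleftrightarrow> smooth_on U X \<and> (\<forall>p\<in>U. inj (frechet_derivative X (at p)))"

definition pseudo_inner :: "real^4 \<Rightarrow> real^4 \<Rightarrow> real" (\<open>\<langle>_,/ _\<rangle>\<close>) where
  "\<langle>x, y\<rangle> = - x$1 * y$1 - x$2 * y$2 + x$3 * y$3 + x$4 * y$4"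

text \<open>Signature of \<open>pseudo_inner\<close> restricted to the subspace \<open>V\<close>, with the number \<open>m\<close> of negative
  squares first; the restriction is nondegenerate iff \<open>m + n = dim V\<close>.\<close>

definition has_signature :: "(real^4) set \<Rightarrow> nat \<Rightarrow> nat \<Rightarrow> bool" where
  "has_signature V m n \<longleftrightarrow> (\<exists>B. independent B \<and> span B = V \<and>
     pairwise (\<lambda>x y. \<langle>x, y\<rangle> = 0) B \<and>
     card {x\<in>B. \<langle>x, x\<rangle> < 0} = m \<and> card {x\<in>B. \<langle>x, x\<rangle> > 0} = n)"

definition lorentzian_plane :: "(real^4) set \<Rightarrow> bool" where
  "lorentzian_plane V \<longleftrightarrow> subspace V \<and> dim V = 2 \<and>
     (\<forall>x\<in>V. (\<forall>y\<in>V. \<langle>x, y\<rangle> = 0) \<longrightarrow> x = 0) \<and> has_signature V 1 1"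

definition tangent_plane :: "(real^2 \<Rightarrow> real^4) \<Rightarrow> real^2 \<Rightarrow> (real^4) set" where
  "tangent_plane X p = range (frechet_derivative X (at p))"

definition normal_plane :: "(real^2 \<Rightarrow> real^4) \<Rightarrow> real^2 \<Rightarrow> (real^4) set" where
  "normal_plane X p = {n. \<forall>v\<in>tangent_plane X p. \<langle>n, v\<rangle> = 0}"

definition lorentzian_surface :: "(real^2) set \<Rightarrow> (real^2 \<Rightarrow> real^4) \<Rightarrow> bool" where
  "lorentzian_surface U X \<longleftrightarrow> (\<forall>p\<in>U. lorentzian_plane (tangent_plane X p))"

definition adapted_frame ::
  "(real^2) set \<Rightarrow> (real^2 \<Rightarrow> real^4) \<Rightarrow> (real^2 \<Rightarrow> real^4) \<Rightarrow> (real^2 \<Rightarrow> real^4) \<Rightarrow>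
   (real^2 \<Rightarrow> real^4) \<Rightarrow> (real^2 \<Rightarrow> real^4) \<Rightarrow> bool" where
  "adapted_frame U X e1 e2 e3 e4 \<longleftrightarrow>
     smooth_on U e1 \<and> smooth_on U e2 \<and> smooth_on U e3 \<and> smooth_on U e4 \<and>
     (\<forall>p\<in>U.
        \<langle>e1 p, e2 p\<rangle> = 0 \<and> \<langle>e1 p, e3 p\<rangle> = 0 \<and> \<langle>e1 p, e4 p\<rangle> = 0 \<and>
        \<langle>e2 p, e3 p\<rangle> = 0 \<and> \<langle>e2 p, e4 p\<rangle> = 0 \<and> \<langle>e3 p, e4 p\<rangle> = 0 \<and>
        span {e3 p, e4 p} = tangent_plane X p \<and> span {e1 p, e2 p} = normal_plane X p \<and>
        \<langle>e1 p, e1 p\<rangle> = -1 \<and> \<langle>e3 p, e3 p\<rangle> = -1 \<and>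
        \<langle>e2 p, e2 p\<rangle> = 1 \<and> \<langle>e4 p, e4 p\<rangle> = 1)"

definition omega3 :: "(real^2 \<Rightarrow> real^4) \<Rightarrow> (real^2 \<Rightarrow> real^4) \<Rightarrow> real^2 \<Rightarrow> real^2 \<Rightarrow> real" where
  "omega3 X e3 p v = - \<langle>frechet_derivative X (at p) v, e3 p\<rangle>"

definition omega4 :: "(real^2 \<Rightarrow> real^4) \<Rightarrow> (real^2 \<Rightarrow> real^4) \<Rightarrow> real^2 \<Rightarrow> real^2 \<Rightarrow> real" where
  "omega4 X e4 p v = \<langle>frechet_derivative X (at p) v, e4 p\<rangle>"

text \<open>For \<open>N = e1\<close> this is \<open>(a, b, c)\<close> at \<open>p\<close>, for \<open>N = e2\<close> its barred version. The coefficients are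
  unique because \<open>omega3\<close>, \<open>omega4\<close> are linearly independent; that the same \<open>b\<close> occurs in both
  equations is the symmetry of the second fundamental form.\<close>

definition sff_coeffs ::
  "(real^2 \<Rightarrow> real^4) \<Rightarrow> (real^2 \<Rightarrow> real^4) \<Rightarrow> (real^2 \<Rightarrow> real^4) \<Rightarrow> (real^2 \<Rightarrow> real^4) \<Rightarrow> real^2 \<Rightarrow>
   real \<times> real \<times> real" where
  "sff_coeffs X e3 e4 N p = (THE (a, b, c). \<forall>v.
     - \<langle>frechet_derivative N (at p) v, e3 p\<rangle> = a * omega3 X e3 p v + b * omega4 X e4 p v \<and>
     \<langle>frechet_derivative N (at p) v, e4 p\<rangle> = - b * omega3 X e3 p v - c * omega4 X e4 p v)"

definition lightlike_GK ::
  "(real^2 \<Rightarrow> real^4) \<Rightarrow> (real^2 \<Rightarrow> real^4) \<Rightarrow> (real^2 \<Rightarrow> real^4) \<Rightarrow>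
   (real^2 \<Rightarrow> real^4) \<Rightarrow> (real^2 \<Rightarrow> real^4) \<Rightarrow> real \<Rightarrow> real \<Rightarrow> real^2 \<Rightarrow> real" where
  "lightlike_GK X e1 e2 e3 e4 s t p =
     (let (a, b, c) = sff_coeffs X e3 e4 e1 p; (a', b', c') = sff_coeffs X e3 e4 e2 p
      in (a * s + a' * t) * (c * s + c' * t) - (b * s + b' * t)\<^sup>2)"

definition LC0 :: "(real^4) set" where
  "LC0 = {x. - (x$1)\<^sup>2 - (x$2)\<^sup>2 + (x$3)\<^sup>2 + (x$4)\<^sup>2 = 0}"

definition lightcone_torus :: "(real^4) set" where
  "lightcone_torus = {x\<in>LC0. (x$1)\<^sup>2 + (x$2)\<^sup>2 = 1}"

definition lightcone_normalize :: "real^4 \<Rightarrow> real^4" where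
  "lightcone_normalize x = x /\<^sub>R sqrt ((x$1)\<^sup>2 + (x$2)\<^sup>2)"

definition lightcone_Gauss_map ::
  "(real^2 \<Rightarrow> real^4) \<Rightarrow> (real^2 \<Rightarrow> real^4) \<Rightarrow> real \<Rightarrow> real^2 \<Rightarrow> real^4" where
  "lightcone_Gauss_map e1 e2 \<sigma> p = lightcone_normalize (e1 p + \<sigma> *\<^sub>R e2 p)"

definition lightcone_height :: "(real^2 \<Rightarrow> real^4) \<Rightarrow> real^4 \<Rightarrow> real^2 \<Rightarrow> real" where
  "lightcone_height X l p = \<langle>X p, l\<rangle>"

definition partial_deriv :: "2 \<Rightarrow> (real^2 \<Rightarrow> real) \<Rightarrow> real^2 \<Rightarrow> real" where
  "partial_deriv i f p = deriv (\<lambda>t. f (p + t *\<^sub>R axis i 1)) 0"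

definition hessian :: "(real^2 \<Rightarrow> real) \<Rightarrow> real^2 \<Rightarrow> real^2^2" where
  "hessian f p = (\<chi> i j. partial_deriv i (partial_deriv j f) p)"

definition degenerate_singular_point :: "(real^2 \<Rightarrow> real) \<Rightarrow> real^2 \<Rightarrow> bool" where
  "degenerate_singular_point f p \<longleftrightarrow>
     partial_deriv 1 f p = 0 \<and> partial_deriv 2 f p = 0 \<and> det (hessian f p) = 0"

text \<open>Rank of the differential below \<open>2\<close>. For a map into the torus the rank may be computed in the
  ambient \<open>\<real>\<^sup>4\<close>, since the inclusion of the torus is an immersion.\<close>

definition singular_point :: "(real^2 \<Rightarrow> real^4) \<Rightarrow> real^2 \<Rightarrow> bool" where
  "singular_point G p \<longleftrightarrow> dim (range (frechet_derivative G (at p))) < 2"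

end

theory Submission
  imports Defs
begin

text \<open>All three conditions say that one bilinear form on the parameter plane is degenerate. For a
  normal field \<open>N\<close> along the surface put \<open>B\<^sub>N(v, w) = \<langle>dN v, dX w\<rangle>\<close> (\<open>shape_form\<close>). Since
  \<open>\<langle>N, dX w\<rangle>\<close> vanishes identically, differentiating it in the direction \<open>v\<close> gives
  \<open>B\<^sub>N(v, w) = - \<langle>N, D\<^sup>2X(v, w)\<rangle>\<close> (\<open>shape_form_eq_second_derivative\<close>). This identity has three uses.

  \<^item> It shows that \<open>B\<^sub>N\<close> depends on \<open>N\<close> only through its value at the point. In particular, for the
    Gauss map \<open>G\<close> and \<open>n = e1 + \<sigma> e2\<close>, which is a nonzero multiple \<open>r G\<close> of \<open>G\<close> at the point, it gives
    \<open>B\<^sub>n = r B\<^sub>G\<close> without any derivative of the normalising factor.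
  \<^item> It identifies the Hessian of the height function in the direction \<open>G(p)\<close> with \<open>- B\<^sub>G\<close> in the
    coordinate basis; the gradient at \<open>p\<close> is zero because \<open>G(p)\<close> is normal.
  \<^item> With the symmetry of second derivatives it makes \<open>B\<^sub>N\<close> symmetric, so that the coefficients
    \<open>a, b, c\<close> exist; up to sign they are the entries of \<open>B\<^sub>N\<close> in the basis that \<open>dX\<close> sends to
    \<open>e3, e4\<close>. As \<open>B\<^sub>N\<close> is linear in \<open>N\<close>, the curvature \<open>K\<^sub>l(1, \<sigma>)\<close> is the determinant of \<open>B\<^sub>n\<close> in
    that basis.

  The Gauss map remains. A vector in the kernel of \<open>dG\<close> lies in the left kernel of \<open>B\<^sub>G\<close>. Conversely,
  let \<open>v\<close> be in the left kernel. Then \<open>dG v\<close> is normal to the surface, and it is orthogonal to \<open>G\<close>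
  because \<open>\<langle>G, G\<rangle> = 0\<close>. In the Lorentzian normal plane only the multiples of the lightlike vector \<open>G\<close>
  are orthogonal to \<open>G\<close>, so \<open>dG v\<close> is radial, and a radial vector tangent to the torus is zero
  (\<open>singular_point_lightcone_Gauss_map_iff\<close>).\<close>

section \<open>Symmetry of second derivatives\<close>

lemma has_real_derivative_along_line:
  fixes f :: "'a::real_normed_vector \<Rightarrow> real"
  assumes "(f has_derivative D) (at (q + s *\<^sub>R v))"
  shows "((\<lambda>s. f (q + s *\<^sub>R v)) has_real_derivative D v) (at s)"
proof -
  have "((\<lambda>s. f (q + s *\<^sub>R v)) has_derivative (\<lambda>h. D (h *\<^sub>R v))) (at s)"
    by (rule has_derivative_compose[where g = f and f = "\<lambda>s. q + s *\<^sub>R v" and f' = "\<lambda>h. h *\<^sub>R v", OF _ assms])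
       (auto intro!: derivative_eq_intros)
  moreover have "(\<lambda>h. D (h *\<^sub>R v)) = (*) (D v)"
    using has_derivative_bounded_linear[OF assms]
    by (auto simp: bounded_linear.linear linear_scale mult.commute)
  ultimately show ?thesis
    by (simp add: has_field_derivative_def)
qed

text \<open>The mean value theorem, used once in the direction \<open>v\<close> and once in the direction \<open>w\<close>, turns the
  second difference over a small parallelogram into a second derivative at a nearby point. The
  second difference does not change when \<open>v\<close> and \<open>w\<close> are swapped.\<close>

lemma second_difference_mean_value:
  fixes f :: "'a::real_normed_vector \<Rightarrow> real"
  assumes f: "\<And>x. x \<in> ball p r \<Longrightarrow> (f has_derivative f' x) (at x)"
    and g: "\<And>x. x \<in> ball p r \<Longrightarrow> ((\<lambda>x. f' x v) has_derivative g x) (at x)"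
    and t: "0 < t" "t * (norm v + norm w) < r"
  shows "\<exists>q\<in>ball p r. f (p + t *\<^sub>R v + t *\<^sub>R w) - f (p + t *\<^sub>R v) - f (p + t *\<^sub>R w) + f p
           = t\<^sup>2 * g q w"
proof -
  have near: "p + s *\<^sub>R v + u *\<^sub>R w \<in> ball p r" if "0 \<le> s" "s \<le> t" "0 \<le> u" "u \<le> t" for s u
  proof -
    have "norm (s *\<^sub>R v + u *\<^sub>R w) \<le> s * norm v + u * norm w"
      using that norm_triangle_ineq[of "s *\<^sub>R v" "u *\<^sub>R w"] by simp
    also have "\<dots> \<le> t * norm v + t * norm w"
      using that by (intro add_mono mult_right_mono) auto
    finally show ?thesis
      using t norm_minus_cancel[of "s *\<^sub>R v + u *\<^sub>R w"]
      by (simp add: dist_norm algebra_simps)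
  qed
  define F where "F s = f (p + t *\<^sub>R w + s *\<^sub>R v) - f (p + s *\<^sub>R v)" for s
  have "DERIV F s :> f' (p + s *\<^sub>R v + t *\<^sub>R w) v - f' (p + s *\<^sub>R v) v" if "0 \<le> s" "s \<le> t" for s
  proof -
    have "p + t *\<^sub>R w + s *\<^sub>R v \<in> ball p r" "p + s *\<^sub>R v \<in> ball p r"
      using near[of s t] near[of s 0] that t by (simp_all add: add_ac)
    from DERIV_diff[OF this[THEN f, THEN has_real_derivative_along_line]]
    show ?thesis by (simp add: F_def[abs_def] add_ac)
  qed
  from MVT2[OF t(1) this]
  obtain \<xi> where \<xi>: "0 < \<xi>" "\<xi> < t"
    "F t - F 0 = t * (f' (p + \<xi> *\<^sub>R v + t *\<^sub>R w) v - f' (p + \<xi> *\<^sub>R v) v)"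
    by auto
  have "DERIV (\<lambda>u. f' (p + \<xi> *\<^sub>R v + u *\<^sub>R w) v) u :> g (p + \<xi> *\<^sub>R v + u *\<^sub>R w) w"
    if "0 \<le> u" "u \<le> t" for u
    using near[of \<xi> u] that \<xi> by (intro has_real_derivative_along_line[OF g]) auto
  from MVT2[OF t(1) this]
  obtain \<eta> where \<eta>: "0 < \<eta>" "\<eta> < t"
    "f' (p + \<xi> *\<^sub>R v + t *\<^sub>R w) v - f' (p + \<xi> *\<^sub>R v) v = t * g (p + \<xi> *\<^sub>R v + \<eta> *\<^sub>R w) w"
    by auto
  have "F t - F 0 = t\<^sup>2 * g (p + \<xi> *\<^sub>R v + \<eta> *\<^sub>R w) w"
    using \<xi>(3) \<eta>(3) by (simp add: power2_eq_square)
  moreover have "F t - F 0 = f (p + t *\<^sub>R v + t *\<^sub>R w) - f (p + t *\<^sub>R v) - f (p + t *\<^sub>R w) + f p"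
    by (simp add: F_def add_ac)
  moreover have "p + \<xi> *\<^sub>R v + \<eta> *\<^sub>R w \<in> ball p r"
    using \<xi> \<eta> by (intro near) auto
  ultimately show ?thesis by metis
qed

text \<open>Equating the two expressions for the second difference over parallelograms that shrink to \<open>p\<close>
  and using continuity gives the symmetry.\<close>

lemma mixed_second_derivatives_commute_real:
  fixes f :: "'a::real_normed_vector \<Rightarrow> real"
  assumes "open U" "p \<in> U"
    and f: "\<And>x. x \<in> U \<Longrightarrow> (f has_derivative f' x) (at x)"
    and g: "\<And>x. x \<in> U \<Longrightarrow> ((\<lambda>x. f' x v) has_derivative g x) (at x)"
    and h: "\<And>x. x \<in> U \<Longrightarrow> ((\<lambda>x. f' x w) has_derivative h x) (at x)"
    and cont: "continuous_on U (\<lambda>x. g x w)" "continuous_on U (\<lambda>x. h x v)"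
  shows "g p w = h p v"
proof (rule ccontr)
  define \<epsilon> where "\<epsilon> = \<bar>g p w - h p v\<bar> / 2"
  assume "g p w \<noteq> h p v"
  hence "\<epsilon> > 0" by (simp add: \<epsilon>_def)
  have ev: "eventually (\<lambda>x. x \<in> U \<and> dist (g x w) (g p w) < \<epsilon> \<and> dist (h x v) (h p v) < \<epsilon>) (nhds p)"
  proof (intro eventually_conj)
    show "eventually (\<lambda>x. x \<in> U) (nhds p)"
      using assms(1,2) by (rule eventually_nhds_in_open)
    have "isCont (\<lambda>x. g x w) p" "isCont (\<lambda>x. h x v) p"
      using cont assms(1,2) by (simp_all add: continuous_on_eq_continuous_at)
    hence "((\<lambda>x. g x w) \<longlongrightarrow> g p w) (nhds p)" "((\<lambda>x. h x v) \<longlongrightarrow> h p v) (nhds p)"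
      using tendsto_at_iff_tendsto_nhds[of "\<lambda>x. g x w" p] tendsto_at_iff_tendsto_nhds[of "\<lambda>x. h x v" p]
      by (simp_all add: isCont_def)
    from this[THEN tendstoD, OF \<open>\<epsilon> > 0\<close>]
    show "eventually (\<lambda>x. dist (g x w) (g p w) < \<epsilon>) (nhds p)"
         "eventually (\<lambda>x. dist (h x v) (h p v) < \<epsilon>) (nhds p)" .
  qed
  then obtain r where r: "r > 0"
    and near: "\<And>x. x \<in> ball p r \<Longrightarrow>
        x \<in> U \<and> dist (g x w) (g p w) < \<epsilon> \<and> dist (h x v) (h p v) < \<epsilon>"
    by (auto simp: eventually_nhds_metric dist_commute)
  \<comment> \<open>the summand \<open>1\<close> keeps the denominator positive when \<open>v = w = 0\<close>\<close>
  define t where "t = r / (norm v + norm w + 1)"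
  have pos: "norm v + norm w + 1 > 0"
    using norm_ge_zero[of v] norm_ge_zero[of w] by linarith
  have t: "0 < t" "t * (norm v + norm w) < r" "t * (norm w + norm v) < r"
    using r pos by (auto simp: t_def field_simps)
  obtain q where q: "q \<in> ball p r"
    "f (p + t *\<^sub>R v + t *\<^sub>R w) - f (p + t *\<^sub>R v) - f (p + t *\<^sub>R w) + f p = t\<^sup>2 * g q w"
    using second_difference_mean_value[of p r f f' v g t w] f g near t by blast
  obtain q' where q': "q' \<in> ball p r"
    "f (p + t *\<^sub>R w + t *\<^sub>R v) - f (p + t *\<^sub>R w) - f (p + t *\<^sub>R v) + f p = t\<^sup>2 * h q' v"
    using second_difference_mean_value[of p r f f' w h t v] f h near t by blast
  have "t\<^sup>2 * g q w = t\<^sup>2 * h q' v"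
    using q(2) q'(2) by (simp add: algebra_simps)
  hence "g q w = h q' v" using t(1) by simp
  moreover have "\<bar>g q w - g p w\<bar> < \<epsilon>" "\<bar>h q' v - h p v\<bar> < \<epsilon>" "\<bar>g p w - h p v\<bar> = 2 * \<epsilon>"
    using near[OF q(1)] near[OF q'(1)] by (simp_all add: dist_real_def \<epsilon>_def)
  ultimately show False by linarith
qed

text \<open>The mean value theorem needs real values, so the symmetry is shown for each component
  \<open>f \<bullet> c\<close>.\<close>

lemma second_derivative_symmetric:
  fixes f :: "'a::real_normed_vector \<Rightarrow> 'b::real_inner"
  assumes "open U" "p \<in> U" and C2: "Ck_on 2 U f"
  shows "frechet_derivative (\<lambda>x. frechet_derivative f (at x) v) (at p) w
       = frechet_derivative (\<lambda>x. frechet_derivative f (at x) w) (at p) v"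
    (is "?L = ?R")
proof -
  have D1: "(f has_derivative frechet_derivative f (at x)) (at x)" if "x \<in> U" for x
    using C2 that by (auto simp: numeral_2_eq_2 frechet_derivative_works)
  have D2: "((\<lambda>x. frechet_derivative f (at x) v) has_derivative
       frechet_derivative (\<lambda>x. frechet_derivative f (at x) v) (at x)) (at x)" if "x \<in> U" for x v
    using C2 that by (auto simp: numeral_2_eq_2 frechet_derivative_works)
  have C: "continuous_on U (\<lambda>x. frechet_derivative (\<lambda>x. frechet_derivative f (at x) v) (at x) w)"
    for v w
    using C2 by (auto simp: numeral_2_eq_2)
  let ?D2 = "\<lambda>z x. frechet_derivative (\<lambda>x. frechet_derivative f (at x) z) (at x)"
  have "?L \<bullet> c = ?R \<bullet> c" for c
  proof (rule mixed_second_derivatives_commute_real[of U p "\<lambda>x. f x \<bullet> c"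
        "\<lambda>x y. frechet_derivative f (at x) y \<bullet> c" v "\<lambda>x y. ?D2 v x y \<bullet> c" w
        "\<lambda>x y. ?D2 w x y \<bullet> c", OF assms(1,2)])
    show "((\<lambda>x. f x \<bullet> c) has_derivative (\<lambda>y. frechet_derivative f (at x) y \<bullet> c)) (at x)"
      if "x \<in> U" for x
      by (rule has_derivative_inner_left[OF D1[OF that]])
    show "((\<lambda>x. frechet_derivative f (at x) v \<bullet> c) has_derivative (\<lambda>y. ?D2 v x y \<bullet> c)) (at x)"
         "((\<lambda>x. frechet_derivative f (at x) w \<bullet> c) has_derivative (\<lambda>y. ?D2 w x y \<bullet> c)) (at x)"
      if "x \<in> U" for x
      by (rule has_derivative_inner_left[OF D2[OF that]])+
    show "continuous_on U (\<lambda>x. ?D2 v x w \<bullet> c)" "continuous_on U (\<lambda>x. ?D2 w x v \<bullet> c)"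
      by (rule continuous_on_inner[OF C continuous_on_const])+
  qed
  thus ?thesis
    using vector_eq_rdot[of ?L ?R] by blast
qed

section \<open>Degenerate bilinear forms on the plane\<close>

definition degenerate_form :: "(real^2 \<Rightarrow> real^2 \<Rightarrow> real) \<Rightarrow> bool" where
  "degenerate_form B \<longleftrightarrow> (\<exists>v. v \<noteq> 0 \<and> (\<forall>w. B v w = 0))"

lemma singular_2x2_iff:
  fixes P Q R S :: real
  shows "P * S - Q * R = 0 \<longleftrightarrow>
    (\<exists>x y. (x \<noteq> 0 \<or> y \<noteq> 0) \<and> x * P + y * Q = 0 \<and> x * R + y * S = 0)" (is "?l \<longleftrightarrow> ?r")
proof
  assume l: ?l
  show ?r
  proof (cases "P = 0 \<and> Q = 0")
    case True
    show ?thesis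
    proof (cases "R = 0 \<and> S = 0")
      case False
      thus ?thesis using True by (intro exI[of _ S] exI[of _ "-R"]) auto
    next
      case True
      show ?thesis
        using \<open>P = 0 \<and> Q = 0\<close> \<open>R = 0 \<and> S = 0\<close> by (intro exI[of _ 1]) simp
    qed
  next
    case False
    thus ?thesis using l by (intro exI[of _ Q] exI[of _ "-P"]) (auto simp: algebra_simps)
  qed
next
  assume ?r
  then obtain x y where xy: "x \<noteq> 0 \<or> y \<noteq> 0" "x * P + y * Q = 0" "x * R + y * S = 0" by blast
  have "x * (P * S - Q * R) = S * (x * P + y * Q) - Q * (x * R + y * S)"
       "y * (P * S - Q * R) = P * (x * R + y * S) - R * (x * P + y * Q)"
    by (simp_all add: algebra_simps)
  thus ?l using xy by auto
qed

text \<open>Degeneracy is tested in two bases: the coordinate basis for the Hessian, and the basis that \<open>dX\<close>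
  maps to the tangent frame for the curvature.\<close>

lemma degenerate_form_iff_gram_det:
  assumes B: "bilinear B"
    and span: "\<And>x. \<exists>\<alpha> \<beta>. x = \<alpha> *\<^sub>R u + \<beta> *\<^sub>R v"
    and indep: "\<And>\<alpha> \<beta>. \<alpha> *\<^sub>R u + \<beta> *\<^sub>R v = 0 \<Longrightarrow> \<alpha> = 0 \<and> \<beta> = 0"
  shows "degenerate_form B \<longleftrightarrow> B u u * B v v - B u v * B v u = 0"
proof -
  have B_comb: "B (\<alpha> *\<^sub>R u + \<beta> *\<^sub>R v) w = \<alpha> * B u w + \<beta> * B v w"
               "B w (\<alpha> *\<^sub>R u + \<beta> *\<^sub>R v) = \<alpha> * B w u + \<beta> * B w v" for \<alpha> \<beta> w
    using B by (simp_all add: bilinear_ladd bilinear_radd bilinear_lmul bilinear_rmul)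
  have "degenerate_form B \<longleftrightarrow> (\<exists>\<alpha> \<beta>. (\<alpha> \<noteq> 0 \<or> \<beta> \<noteq> 0) \<and> (\<forall>w. B (\<alpha> *\<^sub>R u + \<beta> *\<^sub>R v) w = 0))"
    unfolding degenerate_form_def using span indep
    by (metis add.right_neutral scale_eq_0_iff add_0)
  also have "\<dots> \<longleftrightarrow> (\<exists>\<alpha> \<beta>. (\<alpha> \<noteq> 0 \<or> \<beta> \<noteq> 0) \<and>
      \<alpha> * B u u + \<beta> * B v u = 0 \<and> \<alpha> * B u v + \<beta> * B v v = 0)"
  proof -
    have "(\<forall>w. B x w = 0) \<longleftrightarrow> B x u = 0 \<and> B x v = 0" for x
      using span B_comb(2) by (metis add.right_neutral mult_zero_right)
    thus ?thesis by (simp only: flip: B_comb(1))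
  qed
  also have "\<dots> \<longleftrightarrow> B u u * B v v - B v u * B u v = 0"
    by (rule singular_2x2_iff[symmetric])
  finally show ?thesis by (simp add: mult.commute)
qed

lemma degenerate_form_iff_det:
  assumes "bilinear B"
  shows "degenerate_form B \<longleftrightarrow> det (\<chi> i j. B (axis i 1) (axis j 1)) = 0"
proof -
  have "degenerate_form B \<longleftrightarrow> B (axis 1 1) (axis 1 1) * B (axis 2 1) (axis 2 1)
      - B (axis 1 1) (axis 2 1) * B (axis 2 1) (axis 1 1) = 0"
  proof (rule degenerate_form_iff_gram_det[OF assms])
    fix x :: "real^2"
    show "\<exists>\<alpha> \<beta>. x = \<alpha> *\<^sub>R axis 1 1 + \<beta> *\<^sub>R axis 2 1"
      by (intro exI[of _ "x$1"] exI[of _ "x$2"]) (simp add: vec_eq_iff forall_2 axis_def)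
  qed (simp add: vec_eq_iff forall_2 axis_def)
  thus ?thesis by (simp add: det_2)
qed

lemma degenerate_form_scale:
  assumes "c \<noteq> 0" shows "degenerate_form (\<lambda>v w. c * B v w) \<longleftrightarrow> degenerate_form B"
  using assms by (simp add: degenerate_form_def)

lemma singular_point_iff_kernel:
  assumes "G differentiable (at p)"
  shows "singular_point G p \<longleftrightarrow> (\<exists>v. v \<noteq> 0 \<and> frechet_derivative G (at p) v = 0)"
proof -
  let ?D = "frechet_derivative G (at p)"
  have lin: "linear ?D"
    using assms by (rule linear_frechet_derivative)
  have "dim (range ?D) \<le> 2"
    using dim_image_le[OF lin, of UNIV] by simp
  moreover have "dim (range ?D) = 2 \<longleftrightarrow> inj ?D"
    using full_rank_injective[of "matrix ?D"] lin by (simp add: rank_dim_range)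
  ultimately have "singular_point G p \<longleftrightarrow> \<not> inj ?D"
    unfolding singular_point_def by linarith
  thus ?thesis
    using linear_injective_0[OF lin] by auto
qed

section \<open>The pseudo scalar product\<close>

lemma bilinear_pseudo_inner: "bilinear pseudo_inner"
  by (auto simp: bilinear_def pseudo_inner_def intro!: linearI) (simp_all add: algebra_simps)

interpretation pseudo_inner: bounded_bilinear pseudo_inner
  using bilinear_pseudo_inner by (simp add: bilinear_conv_bounded_bilinear)

lemma pseudo_inner_commute: "\<langle>x, y\<rangle> = \<langle>y, x\<rangle>"
  by (simp add: pseudo_inner_def)

lemmas pseudo_inner_linear = pseudo_inner.add_left pseudo_inner.add_right
  pseudo_inner.diff_left pseudo_inner.diff_right
  pseudo_inner.scaleR_left pseudo_inner.scaleR_right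

lemma LC0_iff: "x \<in> LC0 \<longleftrightarrow> \<langle>x, x\<rangle> = 0"
  by (simp add: LC0_def pseudo_inner_def power2_eq_square)

lemma lightlike_time_part_pos:
  assumes "\<langle>x, x\<rangle> = 0" "x \<noteq> 0"
  shows "(x$1)\<^sup>2 + (x$2)\<^sup>2 > 0"
proof (rule ccontr)
  assume "\<not> ?thesis"
  hence "x$1 = 0 \<and> x$2 = 0"
    by (simp add: not_less sum_power2_le_zero_iff)
  moreover from this have "x$3 = 0 \<and> x$4 = 0"
    using assms(1) by (simp add: pseudo_inner_def sum_squares_eq_zero_iff)
  ultimately show False
    using assms(2) by (simp add: vec_eq_iff forall_4)
qed

lemma lightcone_normalize_in_torus:
  assumes "\<langle>x, x\<rangle> = 0" "x \<noteq> 0"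
  shows "lightcone_normalize x \<in> lightcone_torus"
proof -
  have "(x$1)\<^sup>2 + (x$2)\<^sup>2 > 0" using lightlike_time_part_pos[OF assms] .
  hence "inverse (sqrt ((x$1)\<^sup>2 + (x$2)\<^sup>2)) ^ 2 * ((x$1)\<^sup>2 + (x$2)\<^sup>2) = 1"
    by (simp add: power_inverse left_inverse[of "(x$1)\<^sup>2 + (x$2)\<^sup>2", OF less_imp_neq[THEN not_sym]])
  thus ?thesis
    using assms(1) by (simp add: lightcone_torus_def LC0_iff lightcone_normalize_def
      pseudo_inner_linear power_mult_distrib distrib_left)
qed

lemma differentiable_lightcone_normalize:
  assumes "f differentiable (at p)" "(f p $ 1)\<^sup>2 + (f p $ 2)\<^sup>2 > 0"
  shows "(\<lambda>q. lightcone_normalize (f q)) differentiable (at p)"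
proof -
  have c: "(\<lambda>q. f q $ i) differentiable (at p)" for i
    using assms(1) by (rule bounded_linear_vec_nth[THEN bounded_linear_imp_differentiable,
        THEN differentiable_compose])
  have "sqrt differentiable (at ((f p $ 1)\<^sup>2 + (f p $ 2)\<^sup>2))"
    using DERIV_real_sqrt[OF assms(2)] by (auto simp: differentiable_def has_field_derivative_def)
  hence "(\<lambda>q. sqrt ((f q $ 1)\<^sup>2 + (f q $ 2)\<^sup>2)) differentiable (at p)"
    by (rule differentiable_compose[where f = sqrt]) (intro differentiable_add differentiable_power c)
  thus ?thesis
    unfolding lightcone_normalize_def using assms
    by (intro differentiable_scaleR differentiable_inverse) auto
qed

section \<open>The second fundamental form along a normal field\<close>

text \<open>This is the second fundamental form in the direction \<open>N\<close>, up to sign and pulled back to the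
  parameter plane.\<close>

definition shape_form :: "(real^2 \<Rightarrow> real^4) \<Rightarrow> (real^2 \<Rightarrow> real^4) \<Rightarrow> real^2 \<Rightarrow> real^2 \<Rightarrow> real^2 \<Rightarrow> real"
  where "shape_form X N p v w = \<langle>frechet_derivative N (at p) v, frechet_derivative X (at p) w\<rangle>"

lemma bilinear_shape_form:
  assumes "X differentiable (at p)" "N differentiable (at p)"
  shows "bilinear (shape_form X N p)"
proof -
  note lin = linear_frechet_derivative[OF assms(1)] linear_frechet_derivative[OF assms(2)]
  show ?thesis
    unfolding bilinear_def shape_form_def
    by (intro conjI allI linearI)
       (simp_all add: lin[THEN linear_add] lin[THEN linear_scale] pseudo_inner_linear)
qed

lemma smooth_on_Ck: "smooth_on U f \<Longrightarrow> Ck_on k U f"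
  by (simp add: smooth_on_def)

lemma smooth_on_has_derivative:
  assumes "smooth_on U f" "x \<in> U"
  shows "(f has_derivative frechet_derivative f (at x)) (at x)"
  using smooth_on_Ck[OF assms(1), of 1] assms(2) by (simp add: frechet_derivative_works)

lemma smooth_on_has_second_derivative:
  assumes "smooth_on U f" "x \<in> U"
  shows "((\<lambda>x. frechet_derivative f (at x) v) has_derivative
       frechet_derivative (\<lambda>x. frechet_derivative f (at x) v) (at x)) (at x)"
  using smooth_on_Ck[OF assms(1), of 2] assms(2)
  by (simp add: numeral_2_eq_2 frechet_derivative_works)

text \<open>Every orthogonality of derivatives below comes from this product rule: the normality of \<open>N\<close> is
  used with \<open>g\<close> a directional derivative of \<open>X\<close>, the lightlike condition with \<open>f = g = G\<close>.\<close>

lemma derivative_of_constant_product: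
  fixes U :: "'a::real_normed_vector set"
  assumes "open U" "p \<in> U" "\<And>q. q \<in> U \<Longrightarrow> \<langle>f q, g q\<rangle> = c"
    and "(f has_derivative f') (at p)" "(g has_derivative g') (at p)"
  shows "\<langle>f' v, g p\<rangle> + \<langle>f p, g' v\<rangle> = 0"
proof -
  have "((\<lambda>q. \<langle>f q, g q\<rangle>) has_derivative (\<lambda>v. \<langle>f p, g' v\<rangle> + \<langle>f' v, g p\<rangle>)) (at p)"
    by (rule pseudo_inner.FDERIV[OF assms(4,5)])
  moreover have "((\<lambda>q. \<langle>f q, g q\<rangle>) has_derivative (\<lambda>v. 0)) (at p)"
    using has_derivative_transform_within_open[of "\<lambda>_. c" "\<lambda>_. 0" p UNIV U] assms(1-3) by simp
  ultimately have "(\<lambda>v. \<langle>f p, g' v\<rangle> + \<langle>f' v, g p\<rangle>) = (\<lambda>v. 0)"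
    by (rule has_derivative_unique)
  thus ?thesis by (metis add.commute)
qed

text \<open>Differentiate \<open>\<langle>N, dX w\<rangle> = 0\<close>. The right-hand side contains \<open>N\<close> only through its value at
  \<open>p\<close>.\<close>

lemma shape_form_eq_second_derivative:
  assumes "open U" "p \<in> U" "smooth_on U X" "N differentiable (at p)"
    and normal: "\<And>q. q \<in> U \<Longrightarrow> N q \<in> normal_plane X q"
  shows "shape_form X N p v w =
    - \<langle>N p, frechet_derivative (\<lambda>q. frechet_derivative X (at q) w) (at p) v\<rangle>"
proof -
  have "\<langle>N q, frechet_derivative X (at q) w\<rangle> = 0" if "q \<in> U" for q
    using normal[OF that] by (simp add: normal_plane_def tangent_plane_def)
  from derivative_of_constant_product[OF assms(1,2) this assms(4)[unfolded frechet_derivative_works]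
      smooth_on_has_second_derivative[OF assms(3,2)]]
  show ?thesis unfolding shape_form_def by (metis eq_neg_iff_add_eq_0)
qed

lemma shape_form_symmetric:
  assumes "open U" "p \<in> U" "smooth_on U X" "N differentiable (at p)"
    and "\<And>q. q \<in> U \<Longrightarrow> N q \<in> normal_plane X q"
  shows "shape_form X N p v w = shape_form X N p w v"
  by (simp add: shape_form_eq_second_derivative[OF assms]
      second_derivative_symmetric[OF assms(1,2) smooth_on_Ck[OF assms(3)], of w v])

section \<open>The Hessian of the height function\<close>

lemma partial_deriv_eq_frechet:
  assumes "(f has_derivative D) (at p)"
  shows "partial_deriv i f p = D (axis i 1)"
  unfolding partial_deriv_def
  using has_real_derivative_along_line[of f D p 0 "axis i 1"] assms by (simp add: DERIV_imp_deriv)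

lemma partial_deriv_lightcone_height:
  assumes "smooth_on U X" "q \<in> U"
  shows "partial_deriv i (lightcone_height X l) q = \<langle>frechet_derivative X (at q) (axis i 1), l\<rangle>"
proof (rule partial_deriv_eq_frechet)
  show "(lightcone_height X l has_derivative (\<lambda>v. \<langle>frechet_derivative X (at q) v, l\<rangle>)) (at q)"
    using bounded_linear.has_derivative[OF pseudo_inner.bounded_linear_left smooth_on_has_derivative[OF assms], of l]
    by (simp add: lightcone_height_def[abs_def])
qed

lemma hessian_lightcone_height:
  assumes "open U" "p \<in> U" "smooth_on U X"
  shows "hessian (lightcone_height X l) p $ i $ j =
    \<langle>frechet_derivative (\<lambda>q. frechet_derivative X (at q) (axis j 1)) (at p) (axis i 1), l\<rangle>"
proof -
  let ?g = "\<lambda>q. \<langle>frechet_derivative X (at q) (axis j 1), l\<rangle>"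
  have "(?g has_derivative (\<lambda>v. \<langle>frechet_derivative (\<lambda>q. frechet_derivative X (at q) (axis j 1)) (at p) v, l\<rangle>)) (at p)"
    by (rule bounded_linear.has_derivative[OF pseudo_inner.bounded_linear_left smooth_on_has_second_derivative[OF assms(3,2)]])
  hence "(partial_deriv j (lightcone_height X l) has_derivative (\<lambda>v. \<langle>frechet_derivative (\<lambda>q. frechet_derivative X (at q) (axis j 1)) (at p) v, l\<rangle>)) (at p)"
    by (rule has_derivative_transform_within_open[OF _ assms(1,2)])
       (simp add: partial_deriv_lightcone_height[OF assms(3)])
  from partial_deriv_eq_frechet[OF this] show ?thesis by (simp add: hessian_def)
qed

text \<open>The direction of the height function is the constant vector \<open>N p\<close>, so its second derivatives are
  \<open>\<langle>D\<^sup>2X, N p\<rangle>\<close>. In dimension two the determinant does not see the sign by which these differ from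
  \<open>shape_form\<close>.\<close>

lemma degenerate_singular_point_lightcone_height_iff:
  assumes "open U" "p \<in> U" "smooth_on U X" "N differentiable (at p)"
    and normal: "\<And>q. q \<in> U \<Longrightarrow> N q \<in> normal_plane X q"
  shows "degenerate_singular_point (lightcone_height X (N p)) p \<longleftrightarrow>
         degenerate_form (shape_form X N p)"
proof -
  have "partial_deriv i (lightcone_height X (N p)) p = 0" for i
    using normal[OF assms(2)]
    by (simp add: partial_deriv_lightcone_height[OF assms(3,2)] normal_plane_def tangent_plane_def
        pseudo_inner_commute[of _ "N p"])
  hence "degenerate_singular_point (lightcone_height X (N p)) p \<longleftrightarrow>
      det (hessian (lightcone_height X (N p)) p) = 0"
    by (simp add: degenerate_singular_point_def)
  also have "\<dots> \<longleftrightarrow> det (\<chi> i j. shape_form X N p (axis i 1) (axis j 1)) = 0"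
    by (simp add: det_2 hessian_lightcone_height[OF assms(1-3)]
        shape_form_eq_second_derivative[OF assms] pseudo_inner_commute[of _ "N p"])
  also have "\<dots> \<longleftrightarrow> degenerate_form (shape_form X N p)"
    using smooth_on_has_derivative[OF assms(3,2)] assms(4)
    by (intro degenerate_form_iff_det[symmetric] bilinear_shape_form)
       (auto simp: differentiable_def)
  finally show ?thesis .
qed


section \<open>Adapted frames and the lightlike Gauss-Kronecker curvature\<close>

text \<open>The forms \<open>omega3\<close> and \<open>omega4\<close> are the basis dual to the preimages of the tangent frame under the
  injective map \<open>dX\<close>. The sign in \<open>omega3\<close> makes up for \<open>\<langle>e3, e3\<rangle> = -1\<close>.\<close>

lemma tangent_frame_preimages:
  assumes X: "X differentiable (at p)" "inj (frechet_derivative X (at p))"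
    and span: "span {e3 p, e4 p} = tangent_plane X p"
    and orth: "\<langle>e3 p, e4 p\<rangle> = 0" "\<langle>e3 p, e3 p\<rangle> = -1" "\<langle>e4 p, e4 p\<rangle> = 1"
  obtains u3 u4 where "frechet_derivative X (at p) u3 = e3 p" "frechet_derivative X (at p) u4 = e4 p"
    "\<forall>v. v = omega3 X e3 p v *\<^sub>R u3 + omega4 X e4 p v *\<^sub>R u4"
proof -
  let ?D = "frechet_derivative X (at p)"
  have lin: "linear ?D" using X(1) by (rule linear_frechet_derivative)
  have "e3 p \<in> range ?D" "e4 p \<in> range ?D"
    using span by (auto simp: tangent_plane_def intro: span_base)
  then obtain u3 u4 where u: "?D u3 = e3 p" "?D u4 = e4 p" by (metis imageE)
  have "v = omega3 X e3 p v *\<^sub>R u3 + omega4 X e4 p v *\<^sub>R u4" for v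
  proof -
    have "?D v \<in> span {e3 p, e4 p}" by (simp add: span tangent_plane_def)
    then obtain x y where "?D v - x *\<^sub>R e3 p = y *\<^sub>R e4 p"
      by (auto simp: span_insert span_singleton)
    hence xy: "?D v = x *\<^sub>R e3 p + y *\<^sub>R e4 p" by (simp add: algebra_simps)
    hence "omega3 X e3 p v = x" "omega4 X e4 p v = y"
      using orth by (simp_all add: omega3_def omega4_def pseudo_inner_linear
          pseudo_inner_commute[of "e4 p" "e3 p"])
    hence "?D v = ?D (omega3 X e3 p v *\<^sub>R u3 + omega4 X e4 p v *\<^sub>R u4)"
      using xy u by (simp add: linear_add[OF lin] linear_scale[OF lin])
    thus ?thesis using X(2) by (simp add: inj_eq)
  qed
  hence "\<forall>v. v = omega3 X e3 p v *\<^sub>R u3 + omega4 X e4 p v *\<^sub>R u4" by (rule allI)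
  with u show thesis by (rule that)
qed

text \<open>The second equation that defines the coefficients needs the same \<open>b\<close> as the first one; this is where
  symmetry enters and makes the definite description meaningful. Evaluation at \<open>u3\<close> and \<open>u4\<close> gives
  uniqueness.\<close>

lemma sff_coeffs_eq:
  assumes B: "bilinear (shape_form X N p)"
    and sym: "shape_form X N p u4 u3 = shape_form X N p u3 u4"
    and u: "frechet_derivative X (at p) u3 = e3 p" "frechet_derivative X (at p) u4 = e4 p"
    and expand: "\<And>v. v = omega3 X e3 p v *\<^sub>R u3 + omega4 X e4 p v *\<^sub>R u4"
    and orth: "\<langle>e3 p, e4 p\<rangle> = 0" "\<langle>e3 p, e3 p\<rangle> = -1" "\<langle>e4 p, e4 p\<rangle> = 1"
  shows "sff_coeffs X e3 e4 N p =
    (- shape_form X N p u3 u3, - shape_form X N p u3 u4, - shape_form X N p u4 u4)"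
proof -
  let ?S = "shape_form X N p"
  have S: "?S v w = omega3 X e3 p v * ?S u3 w + omega4 X e4 p v * ?S u4 w" for v w
  proof -
    have "?S v w = ?S (omega3 X e3 p v *\<^sub>R u3 + omega4 X e4 p v *\<^sub>R u4) w"
      by (rule arg_cong[OF expand])
    thus ?thesis by (simp only: bilinear_ladd[OF B] bilinear_lmul[OF B] real_scaleR_def)
  qed
  have pair: "\<langle>frechet_derivative N (at p) v, e3 p\<rangle> = ?S v u3"
             "\<langle>frechet_derivative N (at p) v, e4 p\<rangle> = ?S v u4" for v
    using u by (simp_all add: shape_form_def)
  have dual: "omega3 X e3 p u3 = 1" "omega4 X e4 p u3 = 0"
             "omega3 X e3 p u4 = 0" "omega4 X e4 p u4 = 1"
    using u orth by (simp_all add: omega3_def omega4_def pseudo_inner_commute[of "e4 p" "e3 p"])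
  show ?thesis
    unfolding sff_coeffs_def pair
  proof (rule the_equality, goal_cases)
    case 1
    have "- ?S v u3 = - ?S u3 u3 * omega3 X e3 p v + - ?S u3 u4 * omega4 X e4 p v"
         "?S v u4 = - (- ?S u3 u4) * omega3 X e3 p v - - ?S u4 u4 * omega4 X e4 p v" for v
      unfolding S[of v u3] S[of v u4] sym by (simp_all only: mult.commute minus_add_distrib mult_minus_left minus_minus diff_minus_eq_add diff_conv_add_uminus)
    thus ?case by blast
  next
    case (2 abc)
    obtain a b c where abc: "abc = (a, b, c)" by (cases abc)
    from 2 have "- ?S v u3 = a * omega3 X e3 p v + b * omega4 X e4 p v"
      "?S v u4 = - b * omega3 X e3 p v - c * omega4 X e4 p v" for v
      unfolding abc prod.case by blast+
    from this(1)[of u3] this(2)[of u3] this(2)[of u4] show ?case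
      by (simp add: abc dual)
  qed
qed

text \<open>The form of \<open>s e1 + t e2\<close> is \<open>s\<close> times that of \<open>e1\<close> plus \<open>t\<close> times that of \<open>e2\<close>. The curvature is
  therefore its Gram determinant in the basis \<open>u3, u4\<close>: the minus signs of the coefficients cancel in
  the products.\<close>

lemma lightlike_GK_eq_0_iff:
  assumes U: "open U" "p \<in> U" and X: "immersion_on U X"
    and frame: "adapted_frame U X e1 e2 e3 e4"
  shows "lightlike_GK X e1 e2 e3 e4 s t p = 0 \<longleftrightarrow>
    degenerate_form (shape_form X (\<lambda>q. s *\<^sub>R e1 q + t *\<^sub>R e2 q) p)"
proof -
  let ?n = "\<lambda>q. s *\<^sub>R e1 q + t *\<^sub>R e2 q"
  have smX: "smooth_on U X" and inj: "inj (frechet_derivative X (at p))"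
    using X U by (auto simp: immersion_on_def)
  have dX: "X differentiable (at p)"
    by (rule Derivative.differentiableI[OF smooth_on_has_derivative[OF smX U(2)]])
  note lin = linear_frechet_derivative[OF dX]
  have e: "(e1 has_derivative frechet_derivative e1 (at p)) (at p)"
          "(e2 has_derivative frechet_derivative e2 (at p)) (at p)"
    using frame U(2) unfolding adapted_frame_def by (blast intro: smooth_on_has_derivative)+
  note de = e[THEN Derivative.differentiableI]
  have orth: "\<langle>e3 p, e4 p\<rangle> = 0" "\<langle>e3 p, e3 p\<rangle> = -1" "\<langle>e4 p, e4 p\<rangle> = 1"
    and span: "span {e3 p, e4 p} = tangent_plane X p"
    using frame U by (auto simp: adapted_frame_def)
  have normal: "e1 q \<in> normal_plane X q" "e2 q \<in> normal_plane X q" if "q \<in> U" for q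
  proof -
    have "span {e1 q, e2 q} = normal_plane X q" using frame that by (auto simp: adapted_frame_def)
    moreover have "e1 q \<in> span {e1 q, e2 q}" "e2 q \<in> span {e1 q, e2 q}"
      by (simp_all add: span_base)
    ultimately show "e1 q \<in> normal_plane X q" "e2 q \<in> normal_plane X q" by simp_all
  qed
  obtain u3 u4 where u: "frechet_derivative X (at p) u3 = e3 p" "frechet_derivative X (at p) u4 = e4 p"
    and "\<forall>v. v = omega3 X e3 p v *\<^sub>R u3 + omega4 X e4 p v *\<^sub>R u4"
    by (rule tangent_frame_preimages[where X = X and ?e3.0 = e3 and ?e4.0 = e4, OF dX inj span orth])
  from this(3) have expand: "v = omega3 X e3 p v *\<^sub>R u3 + omega4 X e4 p v *\<^sub>R u4" for v
    by (rule spec)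
  note sym = shape_form_symmetric[OF U smX]
  have sff: "sff_coeffs X e3 e4 e1 p =
      (- shape_form X e1 p u3 u3, - shape_form X e1 p u3 u4, - shape_form X e1 p u4 u4)"
    by (rule sff_coeffs_eq[where X = X and N = e1 and ?e3.0 = e3 and ?e4.0 = e4,
          OF bilinear_shape_form[OF dX de(1)] sym[OF de(1) normal(1)] u expand orth])
  have sff': "sff_coeffs X e3 e4 e2 p =
      (- shape_form X e2 p u3 u3, - shape_form X e2 p u3 u4, - shape_form X e2 p u4 u4)"
    by (rule sff_coeffs_eq[where X = X and N = e2 and ?e3.0 = e3 and ?e4.0 = e4,
          OF bilinear_shape_form[OF dX de(2)] sym[OF de(2) normal(2)] u expand orth])
  have n: "(?n has_derivative (\<lambda>v. s *\<^sub>R frechet_derivative e1 (at p) v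
      + t *\<^sub>R frechet_derivative e2 (at p) v)) (at p)"
    by (intro has_derivative_add has_derivative_scaleR_right e)
  have S: "shape_form X ?n p v w = s * shape_form X e1 p v w + t * shape_form X e2 p v w" for v w
    by (simp add: shape_form_def frechet_derivative_at[OF n, symmetric] pseudo_inner_linear)
  have gram: "(- a * s + - a' * t) * (- c * s + - c' * t) - (- b * s + - b' * t)\<^sup>2 =
      (s * a + t * a') * (s * c + t * c') - (s * b + t * b') * (s * b + t * b')"
    for a a' b b' c c' :: real
    by (simp add: power2_eq_square algebra_simps)
  have sym_frame: "shape_form X e1 p u4 u3 = shape_form X e1 p u3 u4"
    "shape_form X e2 p u4 u3 = shape_form X e2 p u3 u4"
    by (rule sym[OF de(1) normal(1)], assumption, rule sym[OF de(2) normal(2)], assumption)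
  have GK: "lightlike_GK X e1 e2 e3 e4 s t p =
      shape_form X ?n p u3 u3 * shape_form X ?n p u4 u4
      - shape_form X ?n p u3 u4 * shape_form X ?n p u4 u3"
    by (simp only: lightlike_GK_def sff sff' Let_def prod.case S sym_frame gram)
  show ?thesis
    unfolding GK
  proof (rule degenerate_form_iff_gram_det[where B = "shape_form X ?n p" and u = u3 and v = u4, symmetric])
    show "bilinear (shape_form X ?n p)"
      by (rule bilinear_shape_form[OF dX Derivative.differentiableI[OF n]])
    show "\<exists>\<alpha> \<beta>. v = \<alpha> *\<^sub>R u3 + \<beta> *\<^sub>R u4" for v
      by (intro exI) (rule expand)
    fix \<alpha> \<beta> :: real
    assume "\<alpha> *\<^sub>R u3 + \<beta> *\<^sub>R u4 = 0"
    hence "frechet_derivative X (at p) (\<alpha> *\<^sub>R u3 + \<beta> *\<^sub>R u4) = 0"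
      by (simp only: linear_0[OF lin])
    hence z: "\<alpha> *\<^sub>R e3 p + \<beta> *\<^sub>R e4 p = 0"
      by (simp only: linear_add[OF lin] linear_scale[OF lin] u)
    have "\<langle>\<alpha> *\<^sub>R e3 p + \<beta> *\<^sub>R e4 p, e3 p\<rangle> = 0" "\<langle>\<alpha> *\<^sub>R e3 p + \<beta> *\<^sub>R e4 p, e4 p\<rangle> = 0"
      by (simp_all add: z pseudo_inner.zero_left)
    thus "\<alpha> = 0 \<and> \<beta> = 0"
      using orth by (simp add: pseudo_inner_linear pseudo_inner_commute[of "e4 p" "e3 p"])
  qed
qed

section \<open>Singularities of the lightcone Gauss map\<close>

lemma lightlike_frame_sum:
  assumes "\<langle>a, b\<rangle> = 0" "\<langle>a, a\<rangle> = -1" "\<langle>b, b\<rangle> = 1" "\<sigma> \<in> {1, -1}"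
  shows "\<langle>a + \<sigma> *\<^sub>R b, a + \<sigma> *\<^sub>R b\<rangle> = 0" "a + \<sigma> *\<^sub>R b \<noteq> 0"
proof -
  have ba: "\<langle>b, a\<rangle> = 0" using assms(1) by (simp add: pseudo_inner_commute)
  show "\<langle>a + \<sigma> *\<^sub>R b, a + \<sigma> *\<^sub>R b\<rangle> = 0"
    using assms ba by (auto simp: pseudo_inner_linear)
  have "\<langle>a + \<sigma> *\<^sub>R b, a\<rangle> = -1" using assms ba by (simp add: pseudo_inner_linear)
  thus "a + \<sigma> *\<^sub>R b \<noteq> 0" by (auto simp: pseudo_inner.zero_left)
qed

text \<open>In a Lorentzian plane the orthogonal complement of a lightlike line is the line itself.\<close>

lemma orthogonal_to_lightlike_in_lorentzian_plane:
  assumes "\<langle>a, b\<rangle> = 0" "\<langle>a, a\<rangle> = -1" "\<langle>b, b\<rangle> = 1" "\<sigma> \<in> {1, -1}"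
    and y: "y \<in> span {a, b}" "\<langle>y, a + \<sigma> *\<^sub>R b\<rangle> = 0"
  shows "\<exists>k. y = k *\<^sub>R (a + \<sigma> *\<^sub>R b)"
proof -
  obtain \<alpha> \<beta> where "y - \<alpha> *\<^sub>R a = \<beta> *\<^sub>R b"
    using y(1) by (auto simp: span_insert span_singleton)
  hence ab: "y = \<alpha> *\<^sub>R a + \<beta> *\<^sub>R b" by (simp add: algebra_simps)
  have "\<langle>b, a\<rangle> = 0" using assms(1) by (simp add: pseudo_inner_commute)
  hence "\<alpha> = \<sigma> * \<beta>"
    using y(2) assms(1-3) by (simp add: ab pseudo_inner_linear)
  hence "y = \<alpha> *\<^sub>R (a + \<sigma> *\<^sub>R b)"
    using assms(4) by (auto simp: ab algebra_simps)
  thus ?thesis ..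
qed

text \<open>On the torus the first two coordinates have Euclidean length one, and moving radially would change
  that length.\<close>

lemma torus_derivative_not_radial:
  assumes "open U" "p \<in> U" "\<And>q. q \<in> U \<Longrightarrow> G q \<in> lightcone_torus"
    and G: "(G has_derivative G') (at p)" and "G' v = k *\<^sub>R G p"
  shows "G' v = 0"
proof -
  have c: "((\<lambda>q. G q $ i) has_derivative (\<lambda>h. G' h $ i)) (at p)" for i
    by (rule bounded_linear.has_derivative[OF bounded_linear_vec_nth G])
  have D: "((\<lambda>q. G q $ 1 * G q $ 1 + G q $ 2 * G q $ 2) has_derivative
      (\<lambda>h. (G p $ 1 * G' h $ 1 + G' h $ 1 * G p $ 1) + (G p $ 2 * G' h $ 2 + G' h $ 2 * G p $ 2))) (at p)"
    by (intro has_derivative_add has_derivative_mult c)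
  have D0: "((\<lambda>q. G q $ 1 * G q $ 1 + G q $ 2 * G q $ 2) has_derivative (\<lambda>h. 0)) (at p)"
    by (rule has_derivative_transform_within_open[OF has_derivative_const[of 1] assms(1,2)])
       (use assms(3) in \<open>auto simp: lightcone_torus_def power2_eq_square\<close>)
  have "(G p $ 1 * G' v $ 1 + G' v $ 1 * G p $ 1) + (G p $ 2 * G' v $ 2 + G' v $ 2 * G p $ 2) = 0"
    using fun_cong[OF has_derivative_unique[OF D D0], of v] .
  hence "2 * (k * ((G p $ 1)\<^sup>2 + (G p $ 2)\<^sup>2)) = 0"
    by (simp add: assms(5) power2_eq_square algebra_simps)
  moreover have "(G p $ 1)\<^sup>2 + (G p $ 2)\<^sup>2 = 1"
    using assms(2,3) by (auto simp: lightcone_torus_def)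
  ultimately show ?thesis by (simp add: assms(5))
qed

lemma lightcone_Gauss_map_properties:
  assumes frame: "adapted_frame U X e1 e2 e3 e4" and "q \<in> U" and \<sigma>: "\<sigma> \<in> {1, -1}"
  shows lightcone_Gauss_map_in_torus: "lightcone_Gauss_map e1 e2 \<sigma> q \<in> lightcone_torus"
    and lightcone_Gauss_map_normal: "lightcone_Gauss_map e1 e2 \<sigma> q \<in> normal_plane X q"
    and lightcone_Gauss_map_differentiable: "lightcone_Gauss_map e1 e2 \<sigma> differentiable (at q)"
    and lightcone_Gauss_map_parallel:
      "\<exists>r\<noteq>0. e1 q + \<sigma> *\<^sub>R e2 q = r *\<^sub>R lightcone_Gauss_map e1 e2 \<sigma> q"
proof -
  have null: "\<langle>e1 q + \<sigma> *\<^sub>R e2 q, e1 q + \<sigma> *\<^sub>R e2 q\<rangle> = 0" "e1 q + \<sigma> *\<^sub>R e2 q \<noteq> 0"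
    using frame \<open>q \<in> U\<close> by (intro lightlike_frame_sum[OF _ _ _ \<sigma>]; auto simp: adapted_frame_def)+
  note pos = lightlike_time_part_pos[OF null]
  have span: "span {e1 q, e2 q} = normal_plane X q"
    using frame \<open>q \<in> U\<close> by (auto simp: adapted_frame_def)
  show "lightcone_Gauss_map e1 e2 \<sigma> q \<in> lightcone_torus"
    unfolding lightcone_Gauss_map_def by (rule lightcone_normalize_in_torus[OF null])
  show "lightcone_Gauss_map e1 e2 \<sigma> q \<in> normal_plane X q"
    unfolding lightcone_Gauss_map_def lightcone_normalize_def span[symmetric]
    by (intro span_scale span_add span_base) auto
  have "e1 differentiable (at q)" "e2 differentiable (at q)"
    using frame \<open>q \<in> U\<close> smooth_on_has_derivative
    unfolding adapted_frame_def differentiable_def by blast+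
  hence "(\<lambda>q. e1 q + \<sigma> *\<^sub>R e2 q) differentiable (at q)" by simp
  from differentiable_lightcone_normalize[OF this pos]
  show "lightcone_Gauss_map e1 e2 \<sigma> differentiable (at q)"
    by (simp add: lightcone_Gauss_map_def[abs_def])
  show "\<exists>r\<noteq>0. e1 q + \<sigma> *\<^sub>R e2 q = r *\<^sub>R lightcone_Gauss_map e1 e2 \<sigma> q"
  proof -
    let ?r = "sqrt (((e1 q + \<sigma> *\<^sub>R e2 q)$1)\<^sup>2 + ((e1 q + \<sigma> *\<^sub>R e2 q)$2)\<^sup>2)"
    have r: "?r \<noteq> 0" using real_sqrt_gt_zero[OF pos] by (rule less_imp_neq[THEN not_sym])
    moreover have "e1 q + \<sigma> *\<^sub>R e2 q = ?r *\<^sub>R lightcone_Gauss_map e1 e2 \<sigma> q"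
      unfolding lightcone_Gauss_map_def lightcone_normalize_def
      by (simp only: scaleR_scaleR right_inverse[OF r] scaleR_one)
    ultimately show ?thesis by blast
  qed
qed

text \<open>Only the left kernel has to be compared. The derivative of \<open>G\<close> in a direction of the left kernel of the
  form is normal to the surface and orthogonal to \<open>G\<close>, hence radial, hence zero.\<close>

lemma singular_point_lightcone_Gauss_map_iff:
  assumes U: "open U" "p \<in> U" and frame: "adapted_frame U X e1 e2 e3 e4" and \<sigma>: "\<sigma> \<in> {1, -1}"
  shows "singular_point (lightcone_Gauss_map e1 e2 \<sigma>) p \<longleftrightarrow>
    degenerate_form (shape_form X (lightcone_Gauss_map e1 e2 \<sigma>) p)"
proof -
  let ?G = "lightcone_Gauss_map e1 e2 \<sigma>"
  let ?dG = "frechet_derivative ?G (at p)"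
  note G = lightcone_Gauss_map_properties[OF frame _ \<sigma>]
  have dG: "(?G has_derivative ?dG) (at p)"
    using G(3)[OF U(2)] by (simp add: frechet_derivative_works)
  have "?dG v = 0" if deg: "\<And>w. shape_form X ?G p v w = 0" for v
  proof -
    have "?dG v \<in> normal_plane X p"
      using deg by (auto simp: normal_plane_def tangent_plane_def shape_form_def)
    hence normal: "?dG v \<in> span {e1 p, e2 p}"
      using frame U(2) by (auto simp: adapted_frame_def)
    have null: "\<langle>?G q, ?G q\<rangle> = 0" if "q \<in> U" for q
      using G(1)[OF that] by (simp add: lightcone_torus_def LC0_iff)
    have "\<langle>?dG v, ?G p\<rangle> = 0"
      using derivative_of_constant_product[OF U null dG dG, of v]
      by (simp add: pseudo_inner_commute[of "?G p"])
    moreover obtain r where r: "r \<noteq> 0" "e1 p + \<sigma> *\<^sub>R e2 p = r *\<^sub>R ?G p"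
      using G(4)[OF U(2)] by blast
    ultimately have "\<langle>?dG v, e1 p + \<sigma> *\<^sub>R e2 p\<rangle> = 0"
      by (simp add: pseudo_inner_linear)
    with orthogonal_to_lightlike_in_lorentzian_plane[OF _ _ _ \<sigma> normal]
    obtain k where "?dG v = k *\<^sub>R (e1 p + \<sigma> *\<^sub>R e2 p)"
      using frame U(2) by (auto simp: adapted_frame_def)
    hence "?dG v = (k * r) *\<^sub>R ?G p" by (simp add: r)
    with torus_derivative_not_radial[OF U G(1) dG] show ?thesis by blast
  qed
  moreover have "shape_form X ?G p v w = 0" if "?dG v = 0" for v w
    by (simp add: shape_form_def that pseudo_inner.zero_left)
  ultimately show ?thesis
    unfolding singular_point_iff_kernel[OF G(3)[OF U(2)]] degenerate_form_def by blast
qed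

theorem theorem1p2:
  fixes U :: "(real^2) set" and X e1 e2 e3 e4 :: "real^2 \<Rightarrow> real^4"
    and p :: "real^2" and \<sigma> :: real
  assumes "open U"
    and "immersion_on U X"
    and "lorentzian_surface U X"
    and "adapted_frame U X e1 e2 e3 e4"
    and "p \<in> U"
    and "\<sigma> \<in> {1, -1}"
  shows "(degenerate_singular_point (lightcone_height X (lightcone_Gauss_map e1 e2 \<sigma> p)) p \<longleftrightarrow>
          (\<exists>l\<in>lightcone_torus.
             l = lightcone_Gauss_map e1 e2 \<sigma> p \<and> singular_point (lightcone_Gauss_map e1 e2 \<sigma>) p)) \<and>
         ((\<exists>l\<in>lightcone_torus.
             l = lightcone_Gauss_map e1 e2 \<sigma> p \<and> singular_point (lightcone_Gauss_map e1 e2 \<sigma>) p) \<longleftrightarrow>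
          lightlike_GK X e1 e2 e3 e4 1 \<sigma> p = 0)"
proof -
  let ?G = "lightcone_Gauss_map e1 e2 \<sigma>" and ?n = "\<lambda>q. e1 q + \<sigma> *\<^sub>R e2 q"
  note U = \<open>open U\<close> \<open>p \<in> U\<close> and frame = \<open>adapted_frame U X e1 e2 e3 e4\<close>
  note G = lightcone_Gauss_map_properties[OF frame _ \<open>\<sigma> \<in> {1, -1}\<close>]
  have smX: "smooth_on U X" using \<open>immersion_on U X\<close> by (simp add: immersion_on_def)
  have height: "degenerate_singular_point (lightcone_height X (?G p)) p \<longleftrightarrow>
      degenerate_form (shape_form X ?G p)"
    by (rule degenerate_singular_point_lightcone_height_iff[OF U smX G(3)[OF U(2)] G(2)])
  have gauss: "(\<exists>l\<in>lightcone_torus. l = ?G p \<and> singular_point ?G p) \<longleftrightarrow>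
      degenerate_form (shape_form X ?G p)"
    using G(1)[OF U(2)] singular_point_lightcone_Gauss_map_iff[OF U frame \<open>\<sigma> \<in> {1, -1}\<close>] by auto
  have n_normal: "?n q \<in> normal_plane X q" if "q \<in> U" for q
  proof -
    have "span {e1 q, e2 q} = normal_plane X q" using frame that by (auto simp: adapted_frame_def)
    moreover have "?n q \<in> span {e1 q, e2 q}" by (intro span_add span_scale span_base) auto
    ultimately show ?thesis by simp
  qed
  have n_diff: "?n differentiable (at p)"
  proof -
    have "e1 differentiable (at p)" "e2 differentiable (at p)"
      using frame U(2) smooth_on_has_derivative
      unfolding adapted_frame_def differentiable_def by blast+
    thus ?thesis by simp
  qed
  obtain r where r: "r \<noteq> 0" "?n p = r *\<^sub>R ?G p" using G(4)[OF U(2)] by blast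
  \<comment> \<open>equality of \<open>?n\<close> and \<open>r *\<^sub>R ?G\<close> at the single point \<open>p\<close> determines the forms there\<close>
  have "shape_form X ?n p v w = r * shape_form X ?G p v w" for v w
    using shape_form_eq_second_derivative[OF U smX n_diff n_normal, of v w]
      shape_form_eq_second_derivative[OF U smX G(3)[OF U(2)] G(2), of v w]
    by (simp add: r(2) pseudo_inner_linear)
  hence "shape_form X ?n p = (\<lambda>v w. r * shape_form X ?G p v w)" by blast
  hence "degenerate_form (shape_form X ?n p) \<longleftrightarrow> degenerate_form (shape_form X ?G p)"
    using degenerate_form_scale[OF r(1)] by simp
  hence "lightlike_GK X e1 e2 e3 e4 1 \<sigma> p = 0 \<longleftrightarrow> degenerate_form (shape_form X ?G p)"
    using lightlike_GK_eq_0_iff[OF U \<open>immersion_on U X\<close> frame, of 1 \<sigma>] by simp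
  with height gauss show ?thesis by blast
qed

end
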